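(* Let $a,b,c,d\in\mathbb{R}$ and let $A_k^n\in\mathbb{R}_{\max}^{2\times2}$ ($n\ge1$, $k\in\{-n,-n+2,\dots,n-2,n\}$) be the state decision matrices of the max-plus walk with weights $P=\begin{bmatrix} a & b\\ \varepsilon & \varepsilon\end{bmatrix}$ and $Q=\begin{bmatrix}\varepsilon & \varepsilon\\ c & d\end{bmatrix}$ (as defined in the context), and let $\lambda(A_k^n)$ be the max-plus eigenvalue of $A_k^n$. Then the (ordinary) sum $$\sum_{k\in\{-n,-n+2,\dots,n-2,n\}}\lambda(A_k^n)$$ is a conserved quantity with respect to $n$ (i.e. has the same value for all $n\ge1$) if and only if $$a+d=0\quad\text{and}\quad b+c=0.$$ In that case the conserved quantity is $0$.
   Context: Max-plus algebra: $\mathbb{R}_{\max}=\mathbb{R}\cup\{-\infty\}$ with $x\oplus y=\max\{x,y\}$ and $x\otimes y=x+y$; write $\varepsilon=-\infty$ and $e=0$. Matrix operations are $[A\oplus B]_{ij}=[A]_{ij}\oplus[B]_{ij}$, $[A\otimes B]_{ij}=\bigoplus_k [A]_{ik}\otimes[B]_{kj}$, and $[\alpha\otimes A]_{ij}=\alpha\otimes[A]_{ij}$ for a scalar $\alpha$. Max-plus walk on $\mathbb{Z}$: vectors $\psi_k^n\in\mathbb{R}_{\max}^2$ ($k\in\mathbb{Z}$, $n\ge 0$) evolve by $\psi_k^n=(P\otimes\psi_{k+1}^{n-1})\oplus(Q\otimes\psi_{k-1}^{n-1})$, with initial state supported at position $0$ (i.e. $\psi_k^0=(\varepsilon,\varepsilon)^\top$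 for $k\neq 0$). The state decision matrix $A_k^n$ is the matrix with $\psi_k^n=A_k^n\otimes\psi_0^0$ for every initial $\psi_0^0$. Equivalently, $A_0^0$ is the max-plus identity matrix (diagonal entries $e$, off-diagonal entries $\varepsilon$), $A_k^0$ has all entries $\varepsilon$ for $k\neq0$, and $A_k^n=(P\otimes A_{k+1}^{n-1})\oplus(Q\otimes A_{k-1}^{n-1})$ for $n\ge1$. Eigenvalues: $\lambda\in\mathbb{R}_{\max}$ is an eigenvalue of $A\in\mathbb{R}_{\max}^{N\times N}$ if there is $\bm{x}\in\mathbb{R}_{\max}^N$, not all of whose entries are $\varepsilon$, with $A\otimes\bm{x}=\lambda\otimes\bm{x}$. Each matrix $A_k^n$ with $n\ge1$ and $k\in\{-n,-n+2,\dots,n\}$ has exactly one eigenvalue, denoted $\lambda(A_k^n)$, and it is a real number. *)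

theory Defs
  imports "HOL-Analysis.Analysis"
begin

text \<open>The max-plus semiring: the real numbers together with \<open>\<epsilon> = -\<infinity>\<close>. The operations \<open>\<oplus>\<close> and
  \<open>\<otimes>\<close> are the type class operations \<open>+\<close> and \<open>*\<close>, with neutral elements \<open>0\<close> (that is \<open>\<epsilon>\<close>) and
  \<open>1\<close> (that is \<open>e\<close>, the real number zero). In this way the library's matrix operations \<open>+\<close>,
  \<open>**\<close>, \<open>*v\<close>, \<open>*s\<close> and \<open>mat 1\<close> at this type are the max-plus ones.\<close>

datatype rmax = Eps | Fin (real_of_rmax: real)

instantiation rmax :: comm_semiring_1
begin

definition zero_rmax :: rmax where "0 = Eps"

definition one_rmax :: rmax where "1 = Fin 0"

fun plus_rmax :: "rmax \<Rightarrow> rmax \<Rightarrow> rmax" where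
  "Eps + y = y"
| "x + Eps = x"
| "Fin x + Fin y = Fin (max x y)"

fun times_rmax :: "rmax \<Rightarrow> rmax \<Rightarrow> rmax" where
  "Eps * y = Eps"
| "x * Eps = Eps"
| "Fin x * Fin y = Fin (x + y)"

instance
proof
  fix a b c :: rmax
  show "a + b + c = a + (b + c)"
    by (cases a; cases b; cases c) auto
  show "a + b = b + a"
    by (cases a; cases b) auto
  show "0 + a = a"
    by (simp add: zero_rmax_def)
  show "a * b * c = a * (b * c)"
    by (cases a; cases b; cases c) auto
  show "a * b = b * a"
    by (cases a; cases b) auto
  show "1 * a = a"
    by (cases a) (auto simp: one_rmax_def)
  show "(a + b) * c = a * c + b * c"
    by (cases a; cases b; cases c) (auto simp: max_def)
  show "0 * a = 0" "a * 0 = 0"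
    by (cases a; simp add: zero_rmax_def)+
  show "(0::rmax) \<noteq> 1"
    by (simp add: zero_rmax_def one_rmax_def)
qed

end

definition maxplus_eigenvalue :: "rmax^'n^'n \<Rightarrow> rmax \<Rightarrow> bool" where
  "maxplus_eigenvalue A l \<longleftrightarrow> (\<exists>x. x \<noteq> 0 \<and> A *v x = l *s x)"

text \<open>Only meaningful for a matrix that has exactly one eigenvalue, this eigenvalue being real.\<close>

definition the_eigenvalue :: "rmax^'n^'n \<Rightarrow> real" where
  "the_eigenvalue A = real_of_rmax (THE l. maxplus_eigenvalue A l)"

text \<open>The state at time \<open>n\<close> and position \<open>k\<close> of the walk started from \<open>\<phi>\<close> at position \<open>0\<close>.\<close>

fun walk :: "rmax^2^2 \<Rightarrow> rmax^2^2 \<Rightarrow> rmax^2 \<Rightarrow> nat \<Rightarrow> int \<Rightarrow> rmax^2" where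
  "walk P Q \<phi> 0 k = (if k = 0 then \<phi> else 0)"
| "walk P Q \<phi> (Suc n) k = P *v walk P Q \<phi> n (k + 1) + Q *v walk P Q \<phi> n (k - 1)"

fun decision_matrix :: "rmax^2^2 \<Rightarrow> rmax^2^2 \<Rightarrow> nat \<Rightarrow> int \<Rightarrow> rmax^2^2" where
  "decision_matrix P Q 0 k = (if k = 0 then mat 1 else 0)"
| "decision_matrix P Q (Suc n) k =
     P ** decision_matrix P Q n (k + 1) + Q ** decision_matrix P Q n (k - 1)"

lemma walk_eq_decision_matrix: "walk P Q \<phi> n k = decision_matrix P Q n k *v \<phi>"
  by (induction n arbitrary: k)
    (simp_all add: matrix_vector_mult_add_rdistrib matrix_vector_mul_assoc)

lemma decision_matrix_unique:
  "(\<forall>\<phi>. walk P Q \<phi> n k = A *v \<phi>) \<longleftrightarrow> A = decision_matrix P Q n k"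
  by (auto simp: walk_eq_decision_matrix matrix_eq)

definition weight_P :: "real \<Rightarrow> real \<Rightarrow> rmax^2^2" where
  "weight_P a b = vector [vector [Fin a, Fin b], vector [Eps, Eps]]"

definition weight_Q :: "real \<Rightarrow> real \<Rightarrow> rmax^2^2" where
  "weight_Q c d = vector [vector [Eps, Eps], vector [Fin c, Fin d]]"

text \<open>The set \<open>{-n, -n+2, \<dots>, n-2, n}\<close>.\<close>

definition positions :: "nat \<Rightarrow> int set" where
  "positions n = (\<lambda>j. 2 * int j - int n) ` {0..n}"

definition eigenvalue_sum :: "real \<Rightarrow> real \<Rightarrow> real \<Rightarrow> real \<Rightarrow> nat \<Rightarrow> real" where
  "eigenvalue_sum a b c d n =
     (\<Sum>k\<in>positions n. the_eigenvalue (decision_matrix (weight_P a b) (weight_Q c d) n k))"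

end

theory Submission
  imports Defs
begin

text \<open>A word in \<open>P\<close> and \<open>Q\<close> contributes one weight for each pair of consecutive letters: \<open>a\<close>, \<open>b\<close>,
  \<open>c\<close>, \<open>d\<close> for \<open>PP\<close>, \<open>PQ\<close>, \<open>QP\<close>, \<open>QQ\<close>. Closing a word with \<open>p\<close> letters \<open>P\<close> and \<open>q\<close> letters \<open>Q\<close> to
  a cycle with \<open>m\<close> blocks of each letter gives the weight \<open>p a + q d + m \<delta>\<close> with
  \<open>\<delta> = b + c - a - d\<close>. Maximising over the possible \<open>m\<close> yields the entries of the decision matrix,
  and its eigenvalue is the larger of its diagonal entries and the mean of its off-diagonal ones:
  for \<open>p, q \<ge> 1\<close> it is \<open>p a + q d + (min p q) \<delta>\<close> if \<open>\<delta> \<ge> 0\<close> and \<open>p a + q d + \<delta> / 2\<close> otherwise. The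
  sums for \<open>n = 1, 2, 3\<close> already force \<open>a + d = 0\<close> and \<open>\<delta> = 0\<close>; conversely, under these equations
  the eigenvalue at position \<open>k\<close> is \<open>- k a\<close>, which is odd in \<open>k\<close>.\<close>

section \<open>Eigenvalues of 2x2 max-plus matrices\<close>

lemma Eps_plus_right [simp]: "x + Eps = x"
  by (cases x) auto

lemma Eps_times_right [simp]: "x * Eps = Eps"
  by (cases x) auto

lemma rmax_vec2_eq_0_iff: "(x :: rmax^2) = 0 \<longleftrightarrow> x $ 1 = Eps \<and> x $ 2 = Eps"
  by (simp add: vec_eq_iff forall_2 zero_rmax_def)

lemma eigen_equation_2:
  "(A :: rmax^2^2) *v x = l *s x \<longleftrightarrow>
     A $ 1 $ 1 * x $ 1 + A $ 1 $ 2 * x $ 2 = l * x $ 1 \<and>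
     A $ 2 $ 1 * x $ 1 + A $ 2 $ 2 * x $ 2 = l * x $ 2"
  by (simp add: vec_eq_iff forall_2 matrix_vector_mult_def sum_2)

lemma maxplus_eigenvalue_2:
  "maxplus_eigenvalue (A :: rmax^2^2) l \<longleftrightarrow>
     (\<exists>u v. \<not> (u = Eps \<and> v = Eps) \<and>
        A $ 1 $ 1 * u + A $ 1 $ 2 * v = l * u \<and> A $ 2 $ 1 * u + A $ 2 $ 2 * v = l * v)"
    (is "?L \<longleftrightarrow> ?R")
proof
  assume ?L
  then show ?R
    unfolding maxplus_eigenvalue_def rmax_vec2_eq_0_iff eigen_equation_2 by blast
next
  assume ?R
  then obtain u v where "\<not> (u = Eps \<and> v = Eps)"
    "A $ 1 $ 1 * u + A $ 1 $ 2 * v = l * u" "A $ 2 $ 1 * u + A $ 2 $ 2 * v = l * v"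
    by blast
  then show ?L
    unfolding maxplus_eigenvalue_def rmax_vec2_eq_0_iff eigen_equation_2
    by (intro exI[of _ "vector [u, v]"]) simp
qed

lemma the_eigenvalue_eqI:
  assumes "\<And>l. maxplus_eigenvalue A l \<longleftrightarrow> l = Fin r"
  shows "the_eigenvalue A = r"
  using assms by (simp add: the_eigenvalue_def)

text \<open>This is the maximal cycle mean of a graph with two nodes: loops \<open>x\<close> and
  \<open>w\<close>, and a 2-cycle of mean \<open>(y + z) / 2\<close>. As all entries are finite, one
  finite coordinate of an eigenvector makes the eigenvalue and the other coordinate finite, so the
  equations become real ones.\<close>

lemma the_eigenvalue_finite:
  fixes A :: "rmax^2^2"
  assumes A: "A $ 1 $ 1 = Fin x" "A $ 1 $ 2 = Fin y" "A $ 2 $ 1 = Fin z" "A $ 2 $ 2 = Fin w"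
  shows "the_eigenvalue A = max (max x w) ((y + z) / 2)"
proof (rule the_eigenvalue_eqI)
  fix l
  let ?r = "max (max x w) ((y + z) / 2)"
  show "maxplus_eigenvalue A l \<longleftrightarrow> l = Fin ?r"
  proof
    assume "maxplus_eigenvalue A l"
    then obtain u v where uv: "\<not> (u = Eps \<and> v = Eps)"
      "Fin x * u + Fin y * v = l * u" "Fin z * u + Fin w * v = l * v"
      unfolding maxplus_eigenvalue_2 A by blast
    then obtain r s t where [simp]: "l = Fin r" "u = Fin s" "v = Fin t"
      by (cases l; cases u; cases v) auto
    from uv have "max (x + s) (y + t) = r + s" "max (z + s) (w + t) = r + t"
      by simp_all
    \<comment> \<open>If both maxima are attained off the diagonal, adding the equations gives
      \<open>y + z = 2 * r\<close>; otherwise \<open>r\<close> is \<open>x\<close> or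
      \<open>w\<close>.\<close>
    then have "r = ?r"
      by (simp add: max_def field_simps split: if_splits)
    then show "l = Fin ?r" by simp
  next
    assume l: "l = Fin ?r"
    show "maxplus_eigenvalue A l"
    \<comment> \<open>The witnesses are columns of the Kleene star of the matrix normalised by
      \<open>?r\<close>. Column 1 works if node 1 lies on a critical cycle; otherwise the loop at
      node 2 is critical and column 2 works.\<close>
    proof (cases "x = ?r \<or> y + z = 2 * ?r")
      case True
      then have "Fin x * Fin 0 + Fin y * Fin (z - ?r) = l * Fin 0 \<and>
        Fin z * Fin 0 + Fin w * Fin (z - ?r) = l * Fin (z - ?r)"
        unfolding l by (auto simp: max_def field_simps split: if_splits)
      then show ?thesis
        unfolding maxplus_eigenvalue_2 A by blast
    next
      case False
      then have "Fin x * Fin (y - ?r) + Fin y * Fin 0 = l * Fin (y - ?r) \<and>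
        Fin z * Fin (y - ?r) + Fin w * Fin 0 = l * Fin 0"
        unfolding l by (auto simp: max_def field_simps split: if_splits)
      then show ?thesis
        unfolding maxplus_eigenvalue_2 A by blast
    qed
  qed
qed

text \<open>\<open>l = Eps\<close> would make both coordinates \<open>Eps\<close> by the first row,
  so the second row forces \<open>v = Eps\<close> and only the loop \<open>x\<close> is
  left.\<close>

lemma the_eigenvalue_row_1:
  fixes A :: "rmax^2^2"
  assumes A: "A $ 1 $ 1 = Fin x" "A $ 1 $ 2 = Fin y" "A $ 2 $ 1 = Eps" "A $ 2 $ 2 = Eps"
  shows "the_eigenvalue A = x"
proof (rule the_eigenvalue_eqI)
  fix l
  show "maxplus_eigenvalue A l \<longleftrightarrow> l = Fin x"
  proof
    assume "maxplus_eigenvalue A l"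
    then obtain u v where uv: "\<not> (u = Eps \<and> v = Eps)"
      "Fin x * u + Fin y * v = l * u" "Eps = l * v"
      unfolding maxplus_eigenvalue_2 A by auto
    then show "l = Fin x"
      by (cases l; cases u; cases v) auto
  next
    assume "l = Fin x"
    then have "Fin x * Fin 0 + Fin y * Eps = l * Fin 0 \<and> Eps * Fin 0 + Eps * Eps = l * Eps"
      by simp
    then show "maxplus_eigenvalue A l"
      unfolding maxplus_eigenvalue_2 A by blast
  qed
qed

lemma the_eigenvalue_row_2:
  fixes A :: "rmax^2^2"
  assumes A: "A $ 1 $ 1 = Eps" "A $ 1 $ 2 = Eps" "A $ 2 $ 1 = Fin y" "A $ 2 $ 2 = Fin x"
  shows "the_eigenvalue A = x"
proof (rule the_eigenvalue_eqI)
  fix l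
  show "maxplus_eigenvalue A l \<longleftrightarrow> l = Fin x"
  proof
    assume "maxplus_eigenvalue A l"
    then obtain u v where uv: "\<not> (u = Eps \<and> v = Eps)"
      "Eps = l * u" "Fin y * u + Fin x * v = l * v"
      unfolding maxplus_eigenvalue_2 A by auto
    then show "l = Fin x"
      by (cases l; cases u; cases v) auto
  next
    assume "l = Fin x"
    then have "Eps * Eps + Eps * Fin 0 = l * Eps \<and> Fin y * Eps + Fin x * Fin 0 = l * Fin 0"
      by simp
    then show "maxplus_eigenvalue A l"
      unfolding maxplus_eigenvalue_2 A by blast
  qed
qed

section \<open>Decision matrices and maximal word weights\<close>

lemma decision_matrix_outside:
  assumes "\<bar>k\<bar> > int n"
  shows "decision_matrix P Q n k = 0"
  using assms
proof (induction n arbitrary: k)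
  case (Suc n)
  then have "decision_matrix P Q n (k + 1) = 0" "decision_matrix P Q n (k - 1) = 0"
    by simp_all
  then show ?case
    by (simp add: vec_eq_iff matrix_matrix_mult_def)
qed simp

lemma decision_matrix_Suc_entries:
  fixes a b c d :: real and n :: nat and k :: int
  defines "D \<equiv> decision_matrix (weight_P a b) (weight_Q c d)"
  shows "D (Suc n) k $ 1 $ j = Fin a * D n (k + 1) $ 1 $ j + Fin b * D n (k + 1) $ 2 $ j"
    and "D (Suc n) k $ 2 $ j = Fin c * D n (k - 1) $ 1 $ j + Fin d * D n (k - 1) $ 2 $ j"
  by (simp_all add: D_def matrix_matrix_mult_def sum_2 weight_P_def weight_Q_def)

text \<open>In \<open>cyc_weight\<close> the number \<open>m\<close> of blocks ranges over \<open>{1..min p q}\<close>, or is \<open>0\<close> if one of the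
  letters does not occur; a maximum of \<open>m \<delta>\<close> over an interval is attained at one of its ends. In
  \<open>open_weight\<close> the word runs from the first letter to the second one, and the excess number of
  blocks ranges over \<open>{0..min (p - 1) q}\<close>.\<close>

definition cyc_weight :: "real \<Rightarrow> real \<Rightarrow> real \<Rightarrow> nat \<Rightarrow> nat \<Rightarrow> real" where
  "cyc_weight a d \<delta> p q = real p * a + real q * d +
     (if p = 0 \<or> q = 0 then 0 else max \<delta> (real (min p q) * \<delta>))"

definition open_weight :: "real \<Rightarrow> real \<Rightarrow> real \<Rightarrow> real \<Rightarrow> nat \<Rightarrow> nat \<Rightarrow> real" where
  "open_weight a b d \<delta> p q = real (p - 1) * a + real q * d + b +
     max 0 (real (min (p - 1) q) * \<delta>)"

lemma cyc_weight_commute: "cyc_weight a d \<delta> p q = cyc_weight d a \<delta> q p"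
  by (simp add: cyc_weight_def min.commute)

text \<open>A word starting with \<open>P\<close> continues with \<open>P\<close>, paying
  \<open>a\<close>, or with \<open>Q\<close>, paying \<open>b\<close>; in the latter case the rest
  runs from \<open>Q\<close> to the closing \<open>P\<close>.\<close>

lemma cyc_weight_Suc:
  assumes "\<delta> = b + c - a - d" "p > 0" "q > 0"
  shows "cyc_weight a d \<delta> (Suc p) q =
    max (a + cyc_weight a d \<delta> p q) (b + open_weight d c a \<delta> q p)"
proof -
  have *: "max \<delta> (real (min (Suc p) q) * \<delta>) =
    max (max \<delta> (real (min p q) * \<delta>)) (\<delta> + max 0 (real (min (q - 1) p) * \<delta>))"
  proof (cases "\<delta> \<ge> 0")
    case True
    \<comment> \<open>The added 1 is the block that every cycle with both letters has; the open word
      counts only excess blocks.\<close>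
    have "real (min (q - 1) p) + 1 = real (min (Suc p) q)"
      using assms by (auto simp: min_def)
    then have "\<delta> + real (min (q - 1) p) * \<delta> = real (min (Suc p) q) * \<delta>"
      by (metis add.commute distrib_left mult.commute mult.right_neutral)
    moreover have "real (min p q) * \<delta> \<le> real (min (Suc p) q) * \<delta>"
      using True by (intro mult_right_mono) auto
    moreover have "1 * \<delta> \<le> real (min (Suc p) q) * \<delta>"
      using True assms by (intro mult_right_mono) auto
    ultimately show ?thesis
      using True by (simp add: max_def)
  next
    case False
    have "real (min (Suc p) q) * \<delta> \<le> 1 * \<delta>" "real (min p q) * \<delta> \<le> 1 * \<delta>"
      "real (min (q - 1) p) * \<delta> \<le> 0 * \<delta>"
      using False assms by (intro mult_right_mono_neg; auto)+
    then show ?thesis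
      by (simp add: max_def)
  qed
  let ?s = "real (Suc p) * a + real q * d"
  have "cyc_weight a d \<delta> (Suc p) q = ?s + max \<delta> (real (min (Suc p) q) * \<delta>)"
    "a + cyc_weight a d \<delta> p q = ?s + max \<delta> (real (min p q) * \<delta>)"
    "b + open_weight d c a \<delta> q p = ?s + (\<delta> + max 0 (real (min (q - 1) p) * \<delta>))"
    using assms by (simp_all add: cyc_weight_def open_weight_def of_nat_diff algebra_simps)
  then show ?thesis
    by (simp only: * max_add_distrib_right)
qed

lemma cyc_weight_1:
  assumes "\<delta> = b + c - a - d" "q > 0"
  shows "cyc_weight a d \<delta> (Suc 0) q = b + open_weight d c a \<delta> q 0"
  using assms by (simp add: cyc_weight_def open_weight_def of_nat_diff algebra_simps)

text \<open>If the second letter is \<open>Q\<close>, the rest starts with \<open>Q\<close> and also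
  runs to \<open>Q\<close>, hence the cyclic weight.\<close>

lemma open_weight_Suc:
  assumes "\<delta> = b + c - a - d" "p > 0" "q > 0"
  shows "open_weight a b d \<delta> (Suc p) q =
    max (a + open_weight a b d \<delta> p q) (b + cyc_weight d a \<delta> q p)"
proof -
  have *: "max 0 (real (min p q) * \<delta>) =
    max (max 0 (real (min (p - 1) q) * \<delta>)) (max \<delta> (real (min q p) * \<delta>))"
  proof (cases "\<delta> \<ge> 0")
    case True
    have "real (min (p - 1) q) * \<delta> \<le> real (min p q) * \<delta>" "1 * \<delta> \<le> real (min p q) * \<delta>"
      using True assms by (intro mult_right_mono; auto)+
    then show ?thesis
      using True by (simp add: max_def min.commute)
  next
    case False
    have "real (min p q) * \<delta> \<le> 0 * \<delta>" "real (min (p - 1) q) * \<delta> \<le> 0 * \<delta>"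
      using False by (intro mult_right_mono_neg; auto)+
    then show ?thesis
      using False unfolding min.commute[of q p] by (simp only: max_def) argo
  qed
  let ?s = "real p * a + real q * d + b"
  have "open_weight a b d \<delta> (Suc p) q = ?s + max 0 (real (min p q) * \<delta>)"
    "a + open_weight a b d \<delta> p q = ?s + max 0 (real (min (p - 1) q) * \<delta>)"
    "b + cyc_weight d a \<delta> q p = ?s + max \<delta> (real (min q p) * \<delta>)"
    using assms by (simp_all add: cyc_weight_def open_weight_def of_nat_diff algebra_simps)
  then show ?thesis
    by (simp only: * max_add_distrib_right)
qed

lemma open_weight_1: "open_weight a b d \<delta> (Suc 0) q = b + cyc_weight d a \<delta> q 0"
  by (simp add: open_weight_def cyc_weight_def)

text \<open>\<open>P\<close> moves left and \<open>Q\<close> right, so \<open>p\<close> and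
  \<open>q\<close> determine the position. The row is the first letter, the column the letter that
  follows the word. Time 0 is excluded: the identity matrix does not fit the formula.\<close>

lemma decision_matrix_closed_form:
  fixes a b c d :: real
  defines "D \<equiv> decision_matrix (weight_P a b) (weight_Q c d)" and "\<delta> \<equiv> b + c - a - d"
  assumes "p + q = Suc n"
  shows "D (Suc n) (int q - int p) $ 1 $ 1 = (if p = 0 then Eps else Fin (cyc_weight a d \<delta> p q)) \<and>
    D (Suc n) (int q - int p) $ 1 $ 2 = (if p = 0 then Eps else Fin (open_weight a b d \<delta> p q)) \<and>
    D (Suc n) (int q - int p) $ 2 $ 1 = (if q = 0 then Eps else Fin (open_weight d c a \<delta> q p)) \<and>
    D (Suc n) (int q - int p) $ 2 $ 2 = (if q = 0 then Eps else Fin (cyc_weight d a \<delta> q p))"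
  using assms(3)
proof (induction n arbitrary: p q)
  case 0
  then have "p = 1 \<and> q = 0 \<or> p = 0 \<and> q = 1" by auto
  then show ?case
    unfolding D_def decision_matrix_Suc_entries
    by (auto simp: cyc_weight_def open_weight_def mat_def zero_rmax_def one_rmax_def)
next
  case (Suc n)
  \<comment> \<open>Exchanging the letters swaps \<open>a\<close> with \<open>d\<close> and
    \<open>b\<close> with \<open>c\<close> but fixes \<delta>; the second form serves the second
    row.\<close>
  have \<delta>: "\<delta> = b + c - a - d" "\<delta> = c + b - d - a"
    by (simp_all add: \<delta>_def)
  have row_1: "D (Suc (Suc n)) (int q - int p) $ 1 $ 1 =
      (if p = 0 then Eps else Fin (cyc_weight a d \<delta> p q)) \<and>
    D (Suc (Suc n)) (int q - int p) $ 1 $ 2 =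
      (if p = 0 then Eps else Fin (open_weight a b d \<delta> p q))"
  proof (cases p)
    case 0
    \<comment> \<open>At the rightmost position the right neighbour was out of reach one step
      before.\<close>
    with Suc.prems have "D (Suc n) (int q - int p + 1) = 0"
      unfolding D_def by (intro decision_matrix_outside) simp
    with 0 show ?thesis
      unfolding D_def decision_matrix_Suc_entries(1)[of a b c d "Suc n"]
      by (simp add: zero_rmax_def)
  next
    case (Suc p')
    have k: "int q - int p + 1 = int q - int p'" and "p' + q = Suc n"
      using Suc Suc.prems by simp_all
    note IH = Suc.IH[OF this(2), unfolded D_def]
    \<comment> \<open>For \<open>q = 0\<close> only the branch with \<open>a\<close> is finite, for
      \<open>p' = 0\<close> only the one with \<open>b\<close>.\<close>
    consider "q = 0" | "p' = 0" "q > 0" | "p' > 0" "q > 0" by blast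
    then show ?thesis
      unfolding D_def decision_matrix_Suc_entries(1)[of a b c d "Suc n"] k Suc
      by cases (use IH \<open>p' + q = Suc n\<close> in \<open>simp_all add: cyc_weight_1[OF \<delta>(1)] cyc_weight_Suc[OF \<delta>(1)]
        open_weight_1 open_weight_Suc[OF \<delta>(1)]\<close>;
        simp add: cyc_weight_def open_weight_def of_nat_diff algebra_simps)+
  qed
  have row_2: "D (Suc (Suc n)) (int q - int p) $ 2 $ 1 =
      (if q = 0 then Eps else Fin (open_weight d c a \<delta> q p)) \<and>
    D (Suc (Suc n)) (int q - int p) $ 2 $ 2 =
      (if q = 0 then Eps else Fin (cyc_weight d a \<delta> q p))"
  proof (cases q)
    case 0
    with Suc.prems have "D (Suc n) (int q - int p - 1) = 0"
      unfolding D_def by (intro decision_matrix_outside) simp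
    with 0 show ?thesis
      unfolding D_def decision_matrix_Suc_entries(2)[of a b c d "Suc n"]
      by (simp add: zero_rmax_def)
  next
    case (Suc q')
    have k: "int q - int p - 1 = int q' - int p" and "p + q' = Suc n"
      using Suc Suc.prems by simp_all
    note IH = Suc.IH[OF this(2), unfolded D_def]
    consider "p = 0" | "q' = 0" "p > 0" | "q' > 0" "p > 0" by blast
    then show ?thesis
      unfolding D_def decision_matrix_Suc_entries(2)[of a b c d "Suc n"] k Suc
      by cases (use IH \<open>p + q' = Suc n\<close> in \<open>simp_all add: cyc_weight_1[OF \<delta>(2)] cyc_weight_Suc[OF \<delta>(2)]
        open_weight_1 open_weight_Suc[OF \<delta>(2)] max.commute\<close>;
        simp add: cyc_weight_def open_weight_def of_nat_diff algebra_simps)+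
  qed
  show ?case
    using row_1 row_2 by blast
qed

section \<open>Eigenvalues of the decision matrices\<close>

definition walk_eigenvalue :: "real \<Rightarrow> real \<Rightarrow> real \<Rightarrow> nat \<Rightarrow> nat \<Rightarrow> real" where
  "walk_eigenvalue a d \<delta> p q = real p * a + real q * d +
     (if p = 0 \<or> q = 0 then 0 else if \<delta> \<ge> 0 then real (min p q) * \<delta> else \<delta> / 2)"

text \<open>For \<delta> \<ge> 0 the diagonal wins, as the two open words together contribute at
  most \<open>2 * min p q\<close> times \<delta>. For \<delta> < 0 a cyclic word pays \<delta> at
  least once, whereas two open words without excess blocks share a single \<delta>, so their mean
  wins.\<close>

lemma max_cyc_open:
  assumes "\<delta> = b + c - a - d" "p > 0" "q > 0"
  shows "max (max (cyc_weight a d \<delta> p q) (cyc_weight d a \<delta> q p))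
      ((open_weight a b d \<delta> p q + open_weight d c a \<delta> q p) / 2) = walk_eigenvalue a d \<delta> p q"
proof -
  let ?s = "real p * a + real q * d"
  have op: "(open_weight a b d \<delta> p q + open_weight d c a \<delta> q p) / 2 = ?s +
      (\<delta> + max 0 (real (min (p - 1) q) * \<delta>) + max 0 (real (min (q - 1) p) * \<delta>)) / 2"
    using assms by (simp add: open_weight_def of_nat_diff field_simps)
  have cy: "cyc_weight a d \<delta> p q = ?s + max \<delta> (real (min p q) * \<delta>)"
    using assms by (simp add: cyc_weight_def)
  show ?thesis
  proof (cases "\<delta> \<ge> 0")
    case True
    have "(1 + real (min (p - 1) q) + real (min (q - 1) p)) * \<delta> \<le> (2 * real (min p q)) * \<delta>"
      using True assms by (intro mult_right_mono) (auto simp: min_def of_nat_diff)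
    moreover have "1 * \<delta> \<le> real (min p q) * \<delta>"
      using True assms by (intro mult_right_mono) auto
    ultimately show ?thesis
      using True assms(2,3) unfolding op cyc_weight_commute[of d a] cy walk_eigenvalue_def
      by (simp add: algebra_simps max_def)
  next
    case False
    have "real (min p q) * \<delta> \<le> 1 * \<delta>" "real (min (p - 1) q) * \<delta> \<le> 0 * \<delta>"
      "real (min (q - 1) p) * \<delta> \<le> 0 * \<delta>"
      using False assms by (intro mult_right_mono_neg; auto)+
    then show ?thesis
      using False assms(2,3) unfolding op cyc_weight_commute[of d a] cy walk_eigenvalue_def
      by (simp add: max_def)
  qed
qed

lemma the_eigenvalue_decision_matrix:
  assumes "p + q = n" "n \<ge> 1"
  shows "the_eigenvalue (decision_matrix (weight_P a b) (weight_Q c d) n (int q - int p)) =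
    walk_eigenvalue a d (b + c - a - d) p q"
proof -
  obtain m where n: "n = Suc m"
    using assms(2) by (cases n) auto
  note entries = decision_matrix_closed_form[OF assms(1)[unfolded n], of a b c d, folded n]
  \<comment> \<open>At the two extreme positions one row is \<open>Eps\<close>; elsewhere all
    entries are finite.\<close>
  consider "p = 0" "q > 0" | "q = 0" "p > 0" | "p > 0" "q > 0"
    using assms by fastforce
  then show ?thesis
  proof cases
    case 1
    with entries show ?thesis
      by (subst the_eigenvalue_row_2) (simp_all add: cyc_weight_def walk_eigenvalue_def)
  next
    case 2
    with entries show ?thesis
      by (subst the_eigenvalue_row_1) (simp_all add: cyc_weight_def walk_eigenvalue_def)
  next
    case 3
    let ?\<delta> = "b + c - a - d"
    have "the_eigenvalue (decision_matrix (weight_P a b) (weight_Q c d) n (int q - int p)) =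
        max (max (cyc_weight a d ?\<delta> p q) (cyc_weight d a ?\<delta> q p))
          ((open_weight a b d ?\<delta> p q + open_weight d c a ?\<delta> q p) / 2)"
      by (rule the_eigenvalue_finite) (use entries 3 in simp_all)
    also have "\<dots> = walk_eigenvalue a d ?\<delta> p q"
      by (rule max_cyc_open[OF refl 3])
    finally show ?thesis .
  qed
qed

section \<open>Summation over the positions\<close>

lemma eigenvalue_sum_eq:
  assumes "n \<ge> 1"
  shows "eigenvalue_sum a b c d n = (\<Sum>j=0..n. walk_eigenvalue a d (b + c - a - d) (n - j) j)"
proof -
  have "inj_on (\<lambda>j. 2 * int j - int n) {0..n}"
    by (simp add: inj_on_def)
  then have "eigenvalue_sum a b c d n = (\<Sum>j=0..n.
      the_eigenvalue (decision_matrix (weight_P a b) (weight_Q c d) n (2 * int j - int n)))"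
    by (simp add: eigenvalue_sum_def positions_def sum.reindex)
  also have "\<dots> = (\<Sum>j=0..n. walk_eigenvalue a d (b + c - a - d) (n - j) j)"
  proof (rule sum.cong)
    fix j assume "j \<in> {0..n}"
    then have "2 * int j - int n = int j - int (n - j)" "n - j + j = n"
      by auto
    then show "the_eigenvalue (decision_matrix (weight_P a b) (weight_Q c d) n (2 * int j - int n)) =
        walk_eigenvalue a d (b + c - a - d) (n - j) j"
      using the_eigenvalue_decision_matrix[of "n - j" j n] assms by simp
  qed simp
  finally show ?thesis .
qed

lemma eigenvalue_sum_zero:
  assumes "a + d = 0" "b + c = 0" "n \<ge> 1"
  shows "eigenvalue_sum a b c d n = 0"
proof -
  have "d = - a" and \<delta>: "b + c - a - d = 0"
    using assms by simp_all
  have "eigenvalue_sum a b c d n = (\<Sum>j=0..n. real (n - j) * a - real j * a)"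
    unfolding eigenvalue_sum_eq[OF assms(3)] \<delta>
    by (rule sum.cong) (simp_all add: walk_eigenvalue_def \<open>d = - a\<close>)
  also have "\<dots> = (\<Sum>j=0..n. real (n - j) * a) - (\<Sum>j=0..n. real j * a)"
    by (rule sum_subtractf)
  \<comment> \<open>Replacing \<open>j\<close> by \<open>n - j\<close> reflects the position
    \<open>k\<close> to \<open>- k\<close>.\<close>
  also have "(\<Sum>j=0..n. real (n - j) * a) = (\<Sum>j=0..n. real j * a)"
    by (simp add: sum.atLeastAtMost_rev[of "\<lambda>j. real j * a" 0 n])
  finally show ?thesis by simp
qed

theorem theorem4p1:
  fixes a b c d :: real
  shows "((\<exists>C. \<forall>n\<ge>1. eigenvalue_sum a b c d n = C) \<longleftrightarrow> a + d = 0 \<and> b + c = 0) \<and>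
         (a + d = 0 \<and> b + c = 0 \<longrightarrow> (\<forall>n\<ge>1. eigenvalue_sum a b c d n = 0))"
proof -
  have "a + d = 0 \<and> b + c = 0" if "\<forall>n\<ge>1. eigenvalue_sum a b c d n = C" for C
  proof -
    let ?\<delta> = "b + c - a - d"
    have "eigenvalue_sum a b c d 1 = a + d"
      by (simp add: eigenvalue_sum_eq walk_eigenvalue_def)
    moreover have "eigenvalue_sum a b c d 2 = 3 * (a + d) + (if ?\<delta> \<ge> 0 then ?\<delta> else ?\<delta> / 2)"
      by (simp add: eigenvalue_sum_eq walk_eigenvalue_def numeral_2_eq_2)
    moreover have "eigenvalue_sum a b c d 3 = 6 * (a + d) + (if ?\<delta> \<ge> 0 then 2 * ?\<delta> else ?\<delta>)"
      by (simp add: eigenvalue_sum_eq walk_eigenvalue_def numeral_3_eq_3)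
    moreover have "eigenvalue_sum a b c d 1 = C" "eigenvalue_sum a b c d 2 = C"
      "eigenvalue_sum a b c d 3 = C"
      using that by simp_all
    \<comment> \<open>With \<open>s = a + d\<close> and \<open>f\<close> the \<delta>-term for
      \<open>n = 2\<close>, the sums are \<open>s\<close>, \<open>3 * s + f\<close> and
      \<open>6 * s + 2 * f\<close>. Equality gives \<open>2 * s + f = 0\<close> and
      \<open>5 * s + 2 * f = 0\<close>, so both vanish; the first two sums alone would leave
      \<open>f = - 2 * s\<close>.\<close>
    ultimately show ?thesis
      by (auto split: if_splits)
  qed
  then show ?thesis
    using eigenvalue_sum_zero by blast
qed

end
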